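(* Let $X$ be an infinite-dimensional complex Banach space and let $T\in L(X)$ be an operator satisfying property $(UW_{\Pi})$, i.e. $\sigma_a(T)\setminus\sigma_{uw}(T)=\Pi(T)$. If $\Pi_a(T)\cap\sigma_{uw}(T)=\emptyset$, then $T$ satisfies property $(Z_{\Pi_a})$, i.e. $\sigma(T)\setminus\sigma_w(T)=\Pi_a(T)$. In particular, property $(Z_{\Pi_a})$ holds for $T$ if $\sigma_{uw}(T)=\sigma_{ubw}(T)$.
   Context: $L(X)$ is the algebra of bounded linear operators on $X$. For $T\in L(X)$, $\alpha(T)=\dim \mathcal{N}(T)$ (kernel) and $\beta(T)=\operatorname{codim}\mathcal{R}(T)$ (range); the index is $\alpha(T)-\beta(T)$. The ascent is $p(T)=\inf\{n\in\mathbb{N}:\mathcal{N}(T^n)=\mathcal{N}(T^{n+1})\}$ and the descent is $q(T)=\inf\{n\in\mathbb{N}:\mathcal{R}(T^n)=\mathcal{R}(T^{n+1})\}$ ($n\ge 0$, $\inf\emptyset=\infty$). $\sigma(T)$ is the spectrum and $\sigma_a(T)$ the approximate point spectrum. $T$ is upper semi-Fredholm if $\mathcal{R}(T)$ is closed and $\alpha(T)<\infty$. Weyl spectrum: $\sigma_w(T)$ is the set of $\lambda\in\mathbb{C}$ such that $T-\lambda I$ is not Fredholm of index $0$. Upper semi-Weyl spectrum: $\sigma_{uw}(T)$ is the set of $\lambda$ such that $T-\lambda I$ is not an upper semi-Fredholm operator of index $\le 0$. For $n\ge 0$ let $T_{[n]}$ be the restriction of $T$ to $\mathcal{R}(T^n)$,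 viewed as a map $\mathcal{R}(T^n)\to\mathcal{R}(T^n)$; $T$ is upper semi-B-Fredholm if for some $n$ the space $\mathcal{R}(T^n)$ is closed and $T_{[n]}$ is upper semi-Fredholm, and its index is then the index of $T_{[n]}$ (independent of such $n$). Upper semi-B-Weyl spectrum: $\sigma_{ubw}(T)$ is the set of $\lambda$ such that $T-\lambda I$ is not an upper semi-B-Fredholm operator of index $\le 0$. $\Pi(T)$ is the set of poles of $T$: those $\lambda\in\sigma(T)$ with $p(T-\lambda I)<\infty$ and $q(T-\lambda I)<\infty$. $\Pi_a(T)$ is the set of left poles of $T$: those $\lambda\in\sigma_a(T)$ such that $p:=p(T-\lambda I)<\infty$ and $\mathcal{R}((T-\lambda I)^{p+1})$ is closed. *)

theory Defs
  imports "HOL-Analysis.Analysis"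
begin

section \<open>Complex Banach spaces\<close>

class complex_banach = banach +
  fixes scaleC :: "complex \<Rightarrow> 'a \<Rightarrow> 'a"  (infixr \<open>*\<^sub>C\<close> 75)
  assumes scaleC_add_right: "a *\<^sub>C (x + y) = a *\<^sub>C x + a *\<^sub>C y"
    and scaleC_add_left: "(a + b) *\<^sub>C x = a *\<^sub>C x + b *\<^sub>C x"
    and scaleC_scaleC: "a *\<^sub>C (b *\<^sub>C x) = (a * b) *\<^sub>C x"
    and scaleC_one: "1 *\<^sub>C x = x"
    and scaleR_scaleC: "r *\<^sub>R x = complex_of_real r *\<^sub>C x"
    and norm_scaleC: "norm (a *\<^sub>C x) = cmod a * norm x"

global_interpretation complex_vector: vector_space "scaleC :: complex \<Rightarrow> 'a \<Rightarrow> 'a::complex_banach"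
  by unfold_locales
    (simp_all add: scaleC_add_right scaleC_add_left scaleC_scaleC scaleC_one)

instantiation complex :: complex_banach
begin
definition scaleC_complex :: "complex \<Rightarrow> complex \<Rightarrow> complex" where
  "scaleC_complex a x = a * x"
instance
  by standard (simp_all add: scaleC_complex_def algebra_simps norm_mult scaleR_conv_of_real)
end

text \<open>The library dimension is 0 on infinite-dimensional spaces, hence the case distinction.\<close>

definition cdim :: "'a::complex_banach set \<Rightarrow> enat" where
  "cdim V = (if \<exists>B. finite B \<and> V \<subseteq> complex_vector.span B
             then enat (complex_vector.dim V) else \<infinity>)"

text \<open>For subspaces \<open>W \<subseteq> V\<close>, the dimension of the quotient \<open>V / W\<close>: the supremum of the sizes
  of finite sets of vectors of \<open>V\<close> whose cosets form a linearly independent family.\<close>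

definition quotient_cdim :: "'a::complex_banach set \<Rightarrow> 'a set \<Rightarrow> enat" where
  "quotient_cdim V W =
     (SUP B \<in> {B. finite B \<and> B \<subseteq> V \<and>
                 (\<forall>c. (\<Sum>b\<in>B. c b *\<^sub>C b) \<in> W \<longrightarrow> (\<forall>b\<in>B. c b = 0))}. enat (card B))"

section \<open>Operators and semi-Fredholm theory\<close>

definition bounded_operator :: "('a::complex_banach \<Rightarrow> 'a) \<Rightarrow> bool" where
  "bounded_operator T \<longleftrightarrow> bounded_linear T \<and> (\<forall>c x. T (c *\<^sub>C x) = c *\<^sub>C T x)"

definition shift :: "('a::complex_banach \<Rightarrow> 'a) \<Rightarrow> complex \<Rightarrow> 'a \<Rightarrow> 'a" where
  "shift T \<mu> = (\<lambda>x. T x - \<mu> *\<^sub>C x)"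

definition kernel :: "('a::complex_banach \<Rightarrow> 'a) \<Rightarrow> 'a set" where
  "kernel T = {x. T x = 0}"

text \<open>The notions with suffix \<open>_on\<close> refer to the restriction of \<open>T\<close> to a subspace \<open>M\<close> with
  \<open>T ` M \<subseteq> M\<close>, viewed as an operator on \<open>M\<close>. With \<open>M = UNIV\<close> they describe \<open>T\<close> itself.\<close>

definition nullity_on :: "'a::complex_banach set \<Rightarrow> ('a \<Rightarrow> 'a) \<Rightarrow> enat" where
  "nullity_on M T = cdim (kernel T \<inter> M)"

definition defect_on :: "'a::complex_banach set \<Rightarrow> ('a \<Rightarrow> 'a) \<Rightarrow> enat" where
  "defect_on M T = quotient_cdim M (T ` M)"

text \<open>Meaningful only if nullity or defect is finite; the value may be \<open>-\<infinity>\<close> or \<open>\<infinity>\<close>.\<close>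

definition index_on :: "'a::complex_banach set \<Rightarrow> ('a \<Rightarrow> 'a) \<Rightarrow> ereal" where
  "index_on M T = ereal_of_enat (nullity_on M T) - ereal_of_enat (defect_on M T)"

definition upper_semi_Fredholm_on :: "'a::complex_banach set \<Rightarrow> ('a \<Rightarrow> 'a) \<Rightarrow> bool" where
  "upper_semi_Fredholm_on M T \<longleftrightarrow>
     closedin (top_of_set M) (T ` M) \<and> nullity_on M T < \<infinity>"

definition Fredholm :: "('a::complex_banach \<Rightarrow> 'a) \<Rightarrow> bool" where
  "Fredholm T \<longleftrightarrow> closed (range T) \<and> nullity_on UNIV T < \<infinity> \<and> defect_on UNIV T < \<infinity>"

definition Weyl :: "('a::complex_banach \<Rightarrow> 'a) \<Rightarrow> bool" where
  "Weyl T \<longleftrightarrow> Fredholm T \<and> index_on UNIV T = 0"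

definition upper_semi_Weyl :: "('a::complex_banach \<Rightarrow> 'a) \<Rightarrow> bool" where
  "upper_semi_Weyl T \<longleftrightarrow> upper_semi_Fredholm_on UNIV T \<and> index_on UNIV T \<le> 0"

text \<open>The index of an upper semi-B-Fredholm operator is the index of the restriction to any
  \<open>range (T ^^ n)\<close> of the required kind, and does not depend on the choice of such an \<open>n\<close>.\<close>

definition upper_semi_B_Weyl :: "('a::complex_banach \<Rightarrow> 'a) \<Rightarrow> bool" where
  "upper_semi_B_Weyl T \<longleftrightarrow>
     (\<exists>n. closed (range (T ^^ n)) \<and> upper_semi_Fredholm_on (range (T ^^ n)) T \<and>
          index_on (range (T ^^ n)) T \<le> 0)"

text \<open>The infimum of the empty set in \<^typ>\<open>enat\<close> is \<open>\<infinity>\<close>.\<close>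

definition ascent :: "('a::complex_banach \<Rightarrow> 'a) \<Rightarrow> enat" where
  "ascent T = Inf (enat ` {n. kernel (T ^^ n) = kernel (T ^^ (n + 1))})"

definition descent :: "('a::complex_banach \<Rightarrow> 'a) \<Rightarrow> enat" where
  "descent T = Inf (enat ` {n. range (T ^^ n) = range (T ^^ (n + 1))})"

section \<open>Spectra\<close>

definition spectrum :: "('a::complex_banach \<Rightarrow> 'a) \<Rightarrow> complex set" where
  "spectrum T = {\<mu>. \<not> (\<exists>S. bounded_operator S \<and> S \<circ> shift T \<mu> = id \<and> shift T \<mu> \<circ> S = id)}"

definition approx_point_spectrum :: "('a::complex_banach \<Rightarrow> 'a) \<Rightarrow> complex set" where
  "approx_point_spectrum T =
     {\<mu>. \<exists>x :: nat \<Rightarrow> 'a. (\<forall>n. norm (x n) = 1) \<and> (\<lambda>n. shift T \<mu> (x n)) \<longlonglongrightarrow> 0}"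

definition Weyl_spectrum :: "('a::complex_banach \<Rightarrow> 'a) \<Rightarrow> complex set" where
  "Weyl_spectrum T = {\<mu>. \<not> Weyl (shift T \<mu>)}"

definition upper_semi_Weyl_spectrum :: "('a::complex_banach \<Rightarrow> 'a) \<Rightarrow> complex set" where
  "upper_semi_Weyl_spectrum T = {\<mu>. \<not> upper_semi_Weyl (shift T \<mu>)}"

definition upper_semi_B_Weyl_spectrum :: "('a::complex_banach \<Rightarrow> 'a) \<Rightarrow> complex set" where
  "upper_semi_B_Weyl_spectrum T = {\<mu>. \<not> upper_semi_B_Weyl (shift T \<mu>)}"

definition poles :: "('a::complex_banach \<Rightarrow> 'a) \<Rightarrow> complex set" where
  "poles T = {\<mu> \<in> spectrum T. ascent (shift T \<mu>) < \<infinity> \<and> descent (shift T \<mu>) < \<infinity>}"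

definition left_poles :: "('a::complex_banach \<Rightarrow> 'a) \<Rightarrow> complex set" where
  "left_poles T =
     {\<mu> \<in> approx_point_spectrum T. ascent (shift T \<mu>) < \<infinity> \<and>
        closed (range (shift T \<mu> ^^ (the_enat (ascent (shift T \<mu>)) + 1)))}"

definition property_UW_Pi :: "('a::complex_banach \<Rightarrow> 'a) \<Rightarrow> bool" where
  "property_UW_Pi T \<longleftrightarrow> approx_point_spectrum T - upper_semi_Weyl_spectrum T = poles T"

definition property_Z_Pi_a :: "('a::complex_banach \<Rightarrow> 'a) \<Rightarrow> bool" where
  "property_Z_Pi_a T \<longleftrightarrow> spectrum T - Weyl_spectrum T = left_poles T"

end

theory Submission
  imports Defs
begin

text \<open>
  Write \<open>S\<close> for \<open>T - \<mu>I\<close> and call the ascent \<open>p\<close>. The proof compares the two spectral sets pointwise.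

  If \<open>\<mu>\<close> is a left pole outside the upper semi-Weyl spectrum, property \<open>(UW\<^sub>\<Pi>)\<close> makes it a pole.
  When the descent and the nullity are finite, the defect is at most the nullity
  (lemma \<open>defect_le_nullity\<close>): for large \<open>d\<close> the space is the sum of \<open>N(S\<^sup>d)\<close> and \<open>R(S\<^sup>d)\<close>, hence the
  cokernel of \<open>S\<close> is a quotient of the cokernel of the restriction of \<open>S\<close> to the
  finite-dimensional space \<open>N(S\<^sup>d)\<close>, where rank-nullity applies. The upper semi-Weyl condition is the
  opposite inequality, so \<open>S\<close> is Weyl.

  Conversely, let \<open>\<mu>\<close> be in the spectrum with \<open>S\<close> Weyl. Then \<open>S\<close> is not injective, since an
  injective Weyl operator is bijective and has a bounded inverse (lemma \<open>approx_point_spectrum_if_Weyl\<close>). So \<open>\<mu>\<close> is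
  in the approximate point spectrum, property \<open>(UW\<^sub>\<Pi>)\<close> makes it a pole, and at a pole the range of
  \<open>S\<^sup>p\<^sup>+\<^sup>1\<close> is closed because it has the closed complement \<open>N(S\<^sup>d)\<close>
  (lemma \<open>closed_range_funpow_of_pole\<close>).

  For the final assertion it suffices that left poles are never in the upper semi-B-Weyl spectrum. The
  witness is the restriction of \<open>S\<close> to \<open>R(S\<^sup>p)\<close>: it is injective with closed range
  \<open>R(S\<^sup>p\<^sup>+\<^sup>1)\<close>, and \<open>R(S\<^sup>p)\<close> itself is closed because \<open>R(S\<^sup>p) + N(S)\<close> is a direct sum equal to the
  preimage of \<open>R(S\<^sup>p\<^sup>+\<^sup>1)\<close> (lemma \<open>upper_semi_B_Weyl_of_left_pole\<close>).

  Both closedness arguments, and the bounded inverse, rest on the open mapping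
  theorem, which is derived from the Baire category theorem: preimages can be chosen with norms bounded
  by a multiple of those of the images (lemma \<open>bounded_preimages\<close>). It follows that an operator range
  is closed if it forms a direct sum with some closed subspace and that sum is closed (lemma
  \<open>closed_range_if_direct_sum_closed\<close>).
\<close>

section \<open>Open mappings and closed operator ranges\<close>

text \<open>The Baire half of the open mapping theorem. The closures of the images of the balls of integer
  radius cover \<open>G\<close>, so one of them contains a relative ball around some \<open>y0\<close>; differences of two points
  near \<open>y0\<close> then give preimages of the points near \<open>0\<close>, up to an error as small as desired, and
  scaling does the rest. Domain and target are subspaces rather than whole spaces because the applications
  below need \<open>UNIV \<times> F\<close> as domain and a proper closed subspace as target.\<close>

lemma approximate_preimages_bound:
  fixes f :: "'b::banach \<Rightarrow> 'c::banach"
  assumes f: "bounded_linear f" and E: "subspace E" and G: "closed G" and fE: "f ` E = G"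
  obtains M where "M > 0"
    and "\<And>y d. y \<in> G \<Longrightarrow> d > 0 \<Longrightarrow> \<exists>x\<in>E. norm x \<le> M * norm y \<and> norm (y - f x) < d"
proof -
  interpret f: bounded_linear f by fact
  have G_sub: "subspace G"
    using E fE f.linear linear_subspace_image by blast
  define C where "C n = G \<inter> closure (f ` (E \<inter> cball 0 (real n)))" for n
  have "\<exists>n. top_of_set G interior_of C n \<noteq> {}"
  proof (rule ccontr)
    assume "\<not> ?thesis"
    then have *: "top_of_set G interior_of C n = {}" for n by blast
    have "top_of_set G interior_of \<Union>(range C) = {}"
    proof (rule Baire_category_alt)
      have "completely_metrizable_space (top_of_set G)"
        using G completely_metrizable_space_closedin completely_metrizable_space_euclidean
          closed_closedin by blast
      then show "completely_metrizable_space (top_of_set G) \<or>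
          locally_compact_space (top_of_set G) \<and> regular_space (top_of_set G)" by blast
      show "countable (range C)" by simp
      show "closedin (top_of_set G) T \<and> top_of_set G interior_of T = {}" if "T \<in> range C" for T
        using that * by (auto simp: C_def closedin_closed_Int)
    qed
    moreover have "\<Union>(range C) = G"
    proof
      show "G \<subseteq> \<Union>(range C)"
      proof
        fix y assume "y \<in> G"
        then obtain x where x: "x \<in> E" "y = f x" using fE by blast
        obtain n where "norm x \<le> real n" using real_arch_simple by blast
        then have "y \<in> f ` (E \<inter> cball 0 (real n))" using x by auto
        then have "y \<in> C n" using \<open>y \<in> G\<close> closure_subset[of "f ` (E \<inter> cball 0 (real n))"] by (auto simp: C_def)
        then show "y \<in> \<Union>(range C)" by blast
      qed
    qed (unfold C_def, blast)
    ultimately have "G = {}"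
      by (metis interior_of_topspace topspace_euclidean_subtopology)
    then show False using G_sub subspace_0 by blast
  qed
  then obtain n y0 where "y0 \<in> top_of_set G interior_of C n" by blast
  then obtain U where U: "openin (top_of_set G) U" "y0 \<in> U" "U \<subseteq> C n"
    by (auto simp: interior_of_def)
  then obtain e where e: "e > 0" "ball y0 e \<inter> G \<subseteq> C n" and y0: "y0 \<in> G"
    by (metis (no_types, lifting) openin_contains_ball order_trans subsetD)
  \<comment> \<open>Differences from a ball of radius \<open>n\<close> have norm at most \<open>2 * n\<close> and reach points of norm
    \<open>e / 2\<close>; the summand \<open>1\<close> only makes \<open>M\<close> positive when \<open>n = 0\<close>.\<close>
  define M where "M = 4 * real n / e + 1"
  show thesis
  proof
    show "M > 0" using e(1) by (simp add: M_def add_nonneg_pos)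
    fix y and d :: real
    assume y: "y \<in> G" and d: "d > 0"
    show "\<exists>x\<in>E. norm x \<le> M * norm y \<and> norm (y - f x) < d"
    proof (cases "y = 0")
      case True
      then show ?thesis using d subspace_0[OF E] by (intro bexI[of _ 0]) (auto simp: f.zero)
    next
      case False
      define s where "s = e / (2 * norm y)"
      have s: "s > 0" using e False by (simp add: s_def)
      have "y0 + s *\<^sub>R y \<in> ball y0 e"
        using e False by (simp add: s_def dist_norm)
      moreover have "y0 + s *\<^sub>R y \<in> G"
        using G_sub y y0 by (simp add: subspace_add subspace_scale)
      ultimately have c1: "y0 + s *\<^sub>R y \<in> closure (f ` (E \<inter> cball 0 (real n)))"
        using e by (auto simp: C_def)
      have c2: "y0 \<in> closure (f ` (E \<inter> cball 0 (real n)))"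
        using e y0 by (auto simp: C_def)
      have sd: "s * d / 2 > 0" using s d by simp
      obtain a where a: "a \<in> E" "norm a \<le> real n" "dist (f a) (y0 + s *\<^sub>R y) < s * d / 2"
        using c1 sd unfolding closure_approachable by fastforce
      obtain b where b: "b \<in> E" "norm b \<le> real n" "dist (f b) y0 < s * d / 2"
        using c2 sd unfolding closure_approachable by fastforce
      define x where "x = (1 / s) *\<^sub>R (a - b)"
      have "x \<in> E" using E a b by (simp add: x_def subspace_diff subspace_scale)
      moreover have "norm x \<le> M * norm y"
      proof -
        have "norm x = norm (a - b) / s" using s by (simp add: x_def)
        also have "\<dots> \<le> (2 * real n) / s"
          using a b norm_triangle_ineq4[of a b] s by (intro divide_right_mono) auto
        also have "\<dots> = 4 * real n / e * norm y" using e False by (simp add: s_def)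
        also have "\<dots> \<le> M * norm y" by (intro mult_right_mono) (auto simp: M_def)
        finally show ?thesis .
      qed
      moreover have "norm (y - f x) < d"
      proof -
        have "s *\<^sub>R (y - f x) = (y0 + s *\<^sub>R y - f a) - (y0 - f b)"
          using s by (simp add: x_def f.scaleR f.diff algebra_simps)
        then have "s * norm (y - f x) = norm ((y0 + s *\<^sub>R y - f a) - (y0 - f b))"
          using s by (metis abs_of_pos norm_scaleR)
        also have "\<dots> \<le> norm (y0 + s *\<^sub>R y - f a) + norm (y0 - f b)"
          by (rule norm_triangle_ineq4)
        also have "\<dots> < s * d" using a(3) b(3) by (simp add: dist_norm norm_minus_commute)
        finally show ?thesis using s by simp
      qed
      ultimately show ?thesis by blast
    qed
  qed
qed

text \<open>The open mapping theorem in quantitative form: successive approximation turns approximate preimages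
  into exact ones. The corrections form a geometrically convergent series, and completeness of the
  domain supplies its sum.\<close>

lemma bounded_preimages:
  fixes f :: "'b::banach \<Rightarrow> 'c::banach"
  assumes f: "bounded_linear f" and E: "subspace E" "closed E"
    and G: "closed G" and fE: "f ` E = G"
  obtains M where "\<And>y. y \<in> G \<Longrightarrow> \<exists>x\<in>E. f x = y \<and> norm x \<le> M * norm y"
proof -
  interpret f: bounded_linear f by fact
  have G_sub: "subspace G"
    using E fE f.linear linear_subspace_image by blast
  obtain M where M: "M > 0"
    and app: "\<And>y d. y \<in> G \<Longrightarrow> d > 0 \<Longrightarrow> \<exists>x\<in>E. norm x \<le> M * norm y \<and> norm (y - f x) < d"
    using approximate_preimages_bound[OF f E(1) G fE] by blast
  have "\<exists>x\<in>E. f x = y \<and> norm x \<le> (2 * M) * norm y" if y: "y \<in> G" for y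
  proof (cases "y = 0")
    case True
    then show ?thesis using subspace_0[OF E(1)] by (intro bexI[of _ 0]) (auto simp: f.zero)
  next
    case False
    define N where "N = norm y"
    have N: "N > 0" using False by (simp add: N_def)
    have "\<exists>x\<in>E. norm x \<le> M * norm z \<and> norm (z - f x) < N / 2 ^ Suc k" if "z \<in> G" for z k
      using app[OF that, of "N / 2 ^ Suc k"] N by simp
    then obtain h where h: "\<And>z k. z \<in> G \<Longrightarrow> h z k \<in> E"
      "\<And>z k. z \<in> G \<Longrightarrow> norm (h z k) \<le> M * norm z"
      "\<And>z k. z \<in> G \<Longrightarrow> norm (z - f (h z k)) < N / 2 ^ Suc k"
      by metis
    \<comment> \<open>\<open>r k\<close> is what is left of \<open>y\<close> after \<open>k\<close> corrections; it halves each time.\<close>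
    define r where "r = rec_nat y (\<lambda>k z. z - f (h z k))"
    define x where "x k = h (r k) k" for k
    have r0: "r 0 = y" and rS: "r (Suc k) = r k - f (x k)" for k
      by (simp_all add: r_def x_def)
    have rG: "r k \<in> G" for k
    proof (induction k)
      case (Suc k)
      then have "f (x k) \<in> G" using fE h(1) by (auto simp: x_def)
      then show ?case using Suc G_sub by (simp add: rS subspace_diff)
    qed (simp add: r0 y)
    have rN: "norm (r k) \<le> N / 2 ^ k" for k
      using h(3)[OF rG] by (cases k) (auto simp: r0 N_def rS x_def intro: less_imp_le)
    have xE: "x k \<in> E" for k using h(1) rG by (simp add: x_def)
    have xN: "norm (x k) \<le> M * N * (1 / 2) ^ k" for k
    proof -
      have "norm (x k) \<le> M * norm (r k)" using h(2) rG by (simp add: x_def)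
      also have "\<dots> \<le> M * (N / 2 ^ k)" using rN M by (intro mult_left_mono) auto
      finally show ?thesis by (simp add: power_divide)
    qed
    have geo: "(\<lambda>k. M * N * (1 / 2) ^ k) sums (M * N * 2)"
      using sums_mult[OF geometric_sums[of "1/2::real"], of "M * N"] by simp
    have sn: "summable (\<lambda>k. norm (x k))"
      by (rule summable_comparison_test'[OF sums_summable[OF geo], of 0]) (use xN in simp)
    have sx: "summable x" using sn by (rule summable_norm_cancel)
    have tel: "(\<Sum>k<n. f (x k)) = y - r n" for n
      by (induction n) (simp_all add: r0 rS)
    have "r \<longlonglongrightarrow> 0"
    proof (rule Lim_null_comparison)
      show "\<forall>\<^sub>F k in sequentially. norm (r k) \<le> N * (1 / 2) ^ k"
        using rN by (simp add: power_divide)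
      show "(\<lambda>k. N * (1 / 2) ^ k) \<longlonglongrightarrow> 0"
        by (intro tendsto_mult_right_zero LIMSEQ_power_zero) simp
    qed
    then have "(\<lambda>n. y - r n) \<longlonglongrightarrow> y - 0" by (intro tendsto_diff tendsto_const)
    then have "(\<lambda>k. f (x k)) sums y" by (simp add: sums_def tel)
    moreover have "(\<lambda>k. f (x k)) sums f (suminf x)"
      using f.sums summable_sums[OF sx] by blast
    ultimately have "f (suminf x) = y" using sums_unique2 by blast
    moreover have "suminf x \<in> E"
    proof (rule closed_sequentially[OF E(2)])
      show "(\<Sum>k<n. x k) \<in> E" for n using E(1) xE by (intro subspace_sum) auto
      show "(\<lambda>n. \<Sum>k<n. x k) \<longlonglongrightarrow> suminf x" using sx summable_LIMSEQ by blast
    qed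
    moreover have "norm (suminf x) \<le> (2 * M) * norm y"
    proof -
      have "norm (suminf x) \<le> (\<Sum>k. norm (x k))" using sn by (rule summable_norm)
      also have "\<dots> \<le> (\<Sum>k. M * N * (1 / 2) ^ k)"
        using sn sums_summable[OF geo] xN by (intro suminf_le) auto
      also have "\<dots> = M * N * 2" using geo by (rule sums_unique[symmetric])
      finally show ?thesis by (simp add: N_def algebra_simps)
    qed
    ultimately show ?thesis by blast
  qed
  then show thesis using that by blast
qed

text \<open>The map \<open>(x, y) \<mapsto> A x + y\<close> sends \<open>UNIV \<times> F\<close> onto a closed space, so small vectors of the sum have
  decompositions with small summands. If \<open>a n\<close> is in the range and tends to \<open>l = A x + y\<close>, then \<open>- y\<close> is
  the \<open>F\<close>-part of every \<open>a n - l\<close>; these parts can be taken to tend to \<open>0\<close>, hence \<open>y = 0\<close>.\<close>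

lemma closed_range_if_direct_sum_closed:
  fixes A :: "'b::banach \<Rightarrow> 'c::banach"
  assumes A: "bounded_linear A" and F: "subspace F" "closed F"
    and disj: "range A \<inter> F \<subseteq> {0}" and cl: "closed {A x + y | x y. y \<in> F}"
  shows "closed (range A)"
proof -
  interpret A: bounded_linear A by fact
  let ?f = "\<lambda>(x, y). A x + y"
  have f: "bounded_linear ?f"
    unfolding case_prod_unfold
    by (intro bounded_linear_add bounded_linear_compose[OF A] bounded_linear_fst bounded_linear_snd)
  have E: "subspace (UNIV \<times> F :: ('b \<times> 'c) set)" "closed (UNIV \<times> F :: ('b \<times> 'c) set)"
    using F by (auto intro: subspace_Times closed_Times)
  have img: "?f ` (UNIV \<times> F) = {A x + y | x y. y \<in> F}" by (auto simp: image_iff)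
  obtain M where M: "\<And>z. z \<in> {A x + y | x y. y \<in> F} \<Longrightarrow>
      \<exists>u\<in>UNIV \<times> F. ?f u = z \<and> norm u \<le> M * norm z"
    using bounded_preimages[OF f E cl img] by blast
  show ?thesis
    unfolding closed_sequential_limits
  proof (intro allI impI)
    fix a l assume "(\<forall>n. a n \<in> range A) \<and> a \<longlonglongrightarrow> l"
    then have a: "\<forall>n. a n \<in> range A" and lim: "a \<longlonglongrightarrow> l" by blast+
    have "\<exists>w. a n = A w" for n using a by blast
    then obtain w where w: "\<And>n. a n = A (w n)" by metis
    have aG: "a n \<in> {A x + y | x y. y \<in> F}" for n
      by (intro CollectI exI[of _ "w n"] exI[of _ 0]) (simp add: w subspace_0[OF F(1)])
    then have "l \<in> {A x + y | x y. y \<in> F}"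
      using closed_sequentially[OF cl] lim by blast
    then obtain x y where l: "l = A x + y" "y \<in> F" by blast
    have "\<exists>u v. v \<in> F \<and> A u + v = a n - l \<and> norm (u, v) \<le> M * norm (a n - l)" for n
    proof -
      have "a n - l = A (w n - x) + (- y)" by (simp add: w l A.diff)
      then have "a n - l \<in> {A x + y | x y. y \<in> F}" using F(1) l(2) subspace_neg by blast
      then obtain u where "u \<in> UNIV \<times> F" "?f u = a n - l" "norm u \<le> M * norm (a n - l)"
        using M by blast
      then show ?thesis
        by (intro exI[of _ "fst u"] exI[of _ "snd u"]) (simp add: case_prod_unfold mem_Times_iff)
    qed
    then obtain u v where uv: "\<And>n. v n \<in> F" "\<And>n. A (u n) + v n = a n - l"
      "\<And>n. norm (u n, v n) \<le> M * norm (a n - l)" by metis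
    have "v n = - y" for n
    proof -
      have "A (w n - x - u n) = v n + y"
        using uv(2)[of n] by (simp add: A.add A.diff w l algebra_simps)
      moreover have "v n + y \<in> F" using F(1) uv(1) l(2) by (simp add: subspace_add)
      ultimately have "v n + y = 0" using disj by (metis IntI insertE empty_iff rangeI subsetD)
      then show ?thesis by (simp add: eq_neg_iff_add_eq_0)
    qed
    moreover have "v \<longlonglongrightarrow> 0"
    proof (rule Lim_null_comparison)
      show "\<forall>\<^sub>F n in sequentially. norm (v n) \<le> M * norm (a n - l)"
        using uv(3) norm_snd_le order_trans by (metis (mono_tags, lifting) always_eventually)
      show "(\<lambda>n. M * norm (a n - l)) \<longlonglongrightarrow> 0"
        using lim by (intro tendsto_mult_right_zero tendsto_norm_zero) (simp add: LIM_zero)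
    qed
    ultimately have "(\<lambda>n. - y) \<longlonglongrightarrow> 0" by presburger
    then have "y = 0" by (metis LIMSEQ_const_iff neg_equal_0_iff_equal)
    then show "l \<in> range A" using l by simp
  qed
qed

section \<open>Kernels and ranges of powers\<close>

lemma clinear_bounded_operator:
  "bounded_operator S \<Longrightarrow> Vector_Spaces.linear scaleC scaleC S"
  unfolding bounded_operator_def
  by unfold_locales (auto simp: linear_simps)

lemma bounded_operator_funpow: "bounded_operator S \<Longrightarrow> bounded_operator (S ^^ n)"
proof (induction n)
  case 0
  then show ?case by (simp add: bounded_operator_def bounded_linear_ident id_def)
next
  case (Suc n)
  then show ?case
    by (auto simp: bounded_operator_def comp_def intro: bounded_linear_compose)
qed

lemma bounded_operator_shift: "bounded_operator T \<Longrightarrow> bounded_operator (shift T \<mu>)"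
proof -
  have "bounded_linear ((*\<^sub>C) \<mu> :: 'a \<Rightarrow> 'a)"
    by (rule bounded_linear_intro[where K = "cmod \<mu>"])
      (simp_all add: scaleC_add_right scaleR_scaleC scaleC_scaleC norm_scaleC mult.commute)
  then show "bounded_operator T \<Longrightarrow> bounded_operator (shift T \<mu>)"
    by (auto simp: bounded_operator_def shift_def scaleC_scaleC mult.commute
        complex_vector.scale_right_diff_distrib intro: bounded_linear_sub)
qed

lemma closed_kernel: "bounded_operator S \<Longrightarrow> closed (kernel S)"
  unfolding kernel_def bounded_operator_def
  by (intro closed_Collect_eq) (auto intro: linear_continuous_on continuous_on_const)

lemma subspace_kernel: "bounded_operator S \<Longrightarrow> subspace (kernel S)"
  unfolding kernel_def bounded_operator_def
  using bounded_linear.linear linear_subspace_kernel by blast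

lemma csubspace_kernel: "bounded_operator S \<Longrightarrow> complex_vector.subspace (kernel S)"
  unfolding kernel_def bounded_operator_def complex_vector.subspace_def
  by (auto simp: linear_simps)

lemma csubspace_range: "bounded_operator S \<Longrightarrow> complex_vector.subspace (range S)"
  using linear.axioms(1) clinear_bounded_operator complex_vector.subspace_UNIV
    module_hom.subspace_image linear_iff_module_hom by metis

lemma kernel_funpow_mono: "bounded_operator S \<Longrightarrow> m \<le> n \<Longrightarrow> kernel (S ^^ m) \<subseteq> kernel (S ^^ n)"
proof -
  assume S: "bounded_operator S" and "m \<le> n"
  then obtain k where n: "n = k + m" by (metis le_add_diff_inverse2)
  have "(S ^^ k) 0 = 0"
    using bounded_operator_funpow[OF S] by (simp add: bounded_operator_def linear_simps)
  then show ?thesis by (auto simp: n kernel_def funpow_add)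
qed

lemma range_funpow_antimono:
  fixes S :: "'b \<Rightarrow> 'b"
  assumes "m \<le> n"
  shows "range (S ^^ n) \<subseteq> range (S ^^ m)"
proof -
  have "S ^^ n = S ^^ m \<circ> S ^^ (n - m)" using assms by (simp flip: funpow_add)
  then show ?thesis by auto
qed

lemma kernel_funpow_stable:
  assumes "bounded_operator S" "kernel (S ^^ p) = kernel (S ^^ (p + 1))" "p \<le> n"
  shows "kernel (S ^^ n) = kernel (S ^^ p)"
  using assms(3)
proof (induction n rule: dec_induct)
  case (step n)
  have "x \<in> kernel (S ^^ n)" if "x \<in> kernel (S ^^ Suc n)" for x
  proof -
    have n: "Suc n = (p + 1) + (n - p)" "n = p + (n - p)" using step by auto
    have "(S ^^ (n - p)) x \<in> kernel (S ^^ (p + 1))"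
      using that n(1) by (metis (mono_tags, lifting) comp_apply funpow_add kernel_def mem_Collect_eq)
    then have "(S ^^ (n - p)) x \<in> kernel (S ^^ p)" using assms(2) by simp
    then show ?thesis
      using n(2) by (metis (mono_tags, lifting) comp_apply funpow_add kernel_def mem_Collect_eq)
  qed
  then have "kernel (S ^^ Suc n) = kernel (S ^^ n)"
    using kernel_funpow_mono[OF assms(1) le_SucI[OF order_refl], of n] by blast
  then show ?case using step.IH by (rule trans)
qed simp

lemma range_funpow_stable:
  fixes S :: "'b \<Rightarrow> 'b"
  assumes "range (S ^^ q) = range (S ^^ (q + 1))" "q \<le> n"
  shows "range (S ^^ n) = range (S ^^ q)"
  using assms(2)
proof (induction n rule: dec_induct)
  case (step n)
  have "range (S ^^ Suc n) = S ` range (S ^^ n)" by (simp add: image_comp)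
  also have "\<dots> = S ` range (S ^^ q)" using step by simp
  also have "\<dots> = range (S ^^ (q + 1))" by (simp add: image_comp)
  finally show ?case using assms(1) by simp
qed simp

lemma Inf_enat_attained:
  assumes "Inf (enat ` A) < \<infinity>"
  shows "the_enat (Inf (enat ` A)) \<in> A"
proof -
  obtain a where "a \<in> A" using assms by (cases "A = {}") (auto simp: top_enat_def[symmetric])
  then have "Inf (enat ` A) \<in> enat ` A" using wellorder_InfI[of "enat a" "enat ` A"] by blast
  then show ?thesis by auto
qed

lemma kernel_funpow_ascent:
  assumes "bounded_operator S" "ascent S < \<infinity>" "the_enat (ascent S) \<le> n"
  shows "kernel (S ^^ n) = kernel (S ^^ the_enat (ascent S))"
proof (rule kernel_funpow_stable[OF assms(1) _ assms(3)])
  show "kernel (S ^^ the_enat (ascent S)) = kernel (S ^^ (the_enat (ascent S) + 1))"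
    using Inf_enat_attained assms(2) unfolding ascent_def by blast
qed

lemma range_funpow_descent:
  assumes "descent S < \<infinity>" "the_enat (descent S) \<le> n"
  shows "range (S ^^ n) = range (S ^^ the_enat (descent S))"
proof (rule range_funpow_stable[OF _ assms(2)])
  show "range (S ^^ the_enat (descent S)) = range (S ^^ (the_enat (descent S) + 1))"
    using Inf_enat_attained assms(1) unfolding descent_def by blast
qed

text \<open>Finite ascent makes the sum of kernel and range direct, finite descent makes it the whole space.\<close>

lemma kernel_range_funpow_disjoint:
  assumes S: "bounded_operator S" and p: "ascent S < \<infinity>" "the_enat (ascent S) \<le> n"
  shows "kernel (S ^^ m) \<inter> range (S ^^ n) \<subseteq> {0}"
proof
  fix y assume "y \<in> kernel (S ^^ m) \<inter> range (S ^^ n)"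
  then obtain x where y: "(S ^^ m) y = 0" "y = (S ^^ n) x" by (auto simp: kernel_def)
  then have "x \<in> kernel (S ^^ (m + n))" by (simp add: kernel_def funpow_add)
  then have "x \<in> kernel (S ^^ n)"
    using kernel_funpow_ascent[OF S p(1), of "m + n"] kernel_funpow_ascent[OF S p(1), of n] p(2) by simp
  then show "y \<in> {0}" using y by (simp add: kernel_def)
qed

lemma kernel_range_funpow_sum:
  assumes S: "bounded_operator S" and q: "descent S < \<infinity>" "the_enat (descent S) \<le> n"
  obtains u v where "u \<in> kernel (S ^^ n)" "v \<in> range (S ^^ n)" "x = u + v"
proof -
  have "range (S ^^ n) = range (S ^^ (n + n))"
    using range_funpow_descent[OF q(1), of n] range_funpow_descent[OF q(1), of "n + n"] q(2) by simp
  then obtain z where z: "(S ^^ n) x = (S ^^ n) ((S ^^ n) z)"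
    by (metis (no_types, lifting) comp_apply funpow_add imageE rangeI)
  have "(S ^^ n) (x - (S ^^ n) z) = 0"
    using bounded_operator_funpow[OF S] z by (simp add: bounded_operator_def linear_simps)
  then show thesis by (intro that[of "x - (S ^^ n) z" "(S ^^ n) z"]) (auto simp: kernel_def)
qed

text \<open>If ascent and descent are both finite, the ranges are stable from the ascent on, so the descent does
  not exceed the ascent: in a decomposition \<open>x = u + v\<close> with \<open>u \<in> N(S\<^sup>d)\<close> and \<open>v \<in> R(S\<^sup>d)\<close> for large \<open>d\<close>,
  the operator \<open>S\<^sup>m\<close> already annihilates \<open>u\<close>.\<close>

lemma range_funpow_ascent:
  assumes S: "bounded_operator S" and p: "ascent S < \<infinity>" "the_enat (ascent S) \<le> m"
    and q: "descent S < \<infinity>" and "m \<le> n"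
  shows "range (S ^^ m) = range (S ^^ n)"
proof
  define d where "d = n + the_enat (descent S)"
  show "range (S ^^ m) \<subseteq> range (S ^^ n)"
  proof
    fix y assume "y \<in> range (S ^^ m)"
    then obtain x where y: "y = (S ^^ m) x" by blast
    obtain u v where uv: "u \<in> kernel (S ^^ d)" "v \<in> range (S ^^ d)" "x = u + v"
      using kernel_range_funpow_sum[OF S q, of d] by (auto simp: d_def)
    have "u \<in> kernel (S ^^ m)"
      using uv(1) kernel_funpow_ascent[OF S p(1), of d] kernel_funpow_ascent[OF S p] p(2) \<open>m \<le> n\<close>
      by (simp add: d_def)
    then have "y = (S ^^ m) v"
      using bounded_operator_funpow[OF S] y uv(3)
      by (simp add: bounded_operator_def linear_simps kernel_def)
    then have "y \<in> range (S ^^ (m + d))" using uv(2) by (auto simp: funpow_add)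
    then show "y \<in> range (S ^^ n)"
      using range_funpow_antimono[of n "m + d" S] by (auto simp: d_def)
  qed
qed (rule range_funpow_antimono[OF \<open>m \<le> n\<close>])

section \<open>Closed ranges at poles and left poles\<close>

text \<open>For large \<open>d\<close> the range of \<open>S\<^sup>d\<close> is closed, since \<open>N(S\<^sup>d)\<close> is a closed complement; and from the
  ascent on all these ranges coincide.\<close>

lemma closed_range_funpow_of_pole:
  assumes S: "bounded_operator S" and p: "ascent S < \<infinity>" "the_enat (ascent S) \<le> m"
    and q: "descent S < \<infinity>"
  shows "closed (range (S ^^ m))"
proof -
  define d where "d = m + the_enat (descent S)"
  have Sd: "bounded_operator (S ^^ d)" using S by (rule bounded_operator_funpow)
  have "closed (range (S ^^ d))"
  proof (rule closed_range_if_direct_sum_closed)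
    show "bounded_linear (S ^^ d)" using Sd by (simp add: bounded_operator_def)
    show "subspace (kernel (S ^^ d))" "closed (kernel (S ^^ d))"
      using Sd by (auto intro: subspace_kernel closed_kernel)
    show "range (S ^^ d) \<inter> kernel (S ^^ d) \<subseteq> {0}"
      using kernel_range_funpow_disjoint[OF S p(1), of d d] p(2) by (auto simp: d_def)
    have "\<exists>x y. z = (S ^^ d) x + y \<and> y \<in> kernel (S ^^ d)" for z
      using kernel_range_funpow_sum[OF S q, of d z]
      by (metis add.commute d_def imageE le_add2)
    then have "{(S ^^ d) x + y | x y. y \<in> kernel (S ^^ d)} = UNIV" by blast
    then show "closed {(S ^^ d) x + y | x y. y \<in> kernel (S ^^ d)}" by simp
  qed
  then show ?thesis using range_funpow_ascent[OF S p q, of d] by (simp add: d_def)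
qed

text \<open>The preimage of \<open>R(S\<^sup>n\<^sup>+\<^sup>1)\<close> under \<open>S\<close> is closed and equals \<open>R(S\<^sup>n) + N(S)\<close>, a direct sum once \<open>n\<close> has
  reached the ascent.\<close>

lemma closed_range_funpow_descends:
  assumes S: "bounded_operator S" and p: "ascent S < \<infinity>" "the_enat (ascent S) \<le> n"
    and cl: "closed (range (S ^^ (n + 1)))"
  shows "closed (range (S ^^ n))"
proof (rule closed_range_if_direct_sum_closed)
  have Sn: "bounded_operator (S ^^ n)" using S by (rule bounded_operator_funpow)
  show "bounded_linear (S ^^ n)" using Sn by (simp add: bounded_operator_def)
  show "subspace (kernel S)" "closed (kernel S)"
    using S by (auto intro: subspace_kernel closed_kernel)
  show "range (S ^^ n) \<inter> kernel S \<subseteq> {0}"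
    using kernel_range_funpow_disjoint[OF S p, of 1] by auto
  interpret S: bounded_linear S using S by (simp add: bounded_operator_def)
  have "{(S ^^ n) x + y | x y. y \<in> kernel S} = S -` range (S ^^ (n + 1))"
  proof (intro equalityI subsetI)
    fix z assume "z \<in> {(S ^^ n) x + y | x y. y \<in> kernel S}"
    then obtain x y where "z = (S ^^ n) x + y" "y \<in> kernel S" by blast
    then have "S z = (S ^^ (n + 1)) x" by (simp add: S.add kernel_def)
    then show "z \<in> S -` range (S ^^ (n + 1))" by auto
  next
    fix z assume "z \<in> S -` range (S ^^ (n + 1))"
    then obtain x where "S z = S ((S ^^ n) x)" by auto
    then have "z - (S ^^ n) x \<in> kernel S" by (simp add: kernel_def S.diff)
    then show "z \<in> {(S ^^ n) x + y | x y. y \<in> kernel S}"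
      by (intro CollectI exI[of _ x] exI[of _ "z - (S ^^ n) x"]) simp
  qed
  then show "closed {(S ^^ n) x + y | x y. y \<in> kernel S}"
    using cl S.continuous_on[OF continuous_on_id] by (simp add: closed_vimage)
qed

lemma nullity_on_eq_0:
  assumes "kernel S \<inter> M \<subseteq> {0}"
  shows "nullity_on M S = 0"
proof -
  have sp: "kernel S \<inter> M \<subseteq> complex_vector.span {}" using assms by simp
  then have "\<exists>B. finite B \<and> kernel S \<inter> M \<subseteq> complex_vector.span B" by blast
  then show ?thesis
    using complex_vector.dim_le_card[OF sp] by (simp add: nullity_on_def cdim_def zero_enat_def)
qed

text \<open>The restriction of \<open>S\<close> to \<open>R(S\<^sup>p)\<close> is injective, so its index is minus its defect, whether or not
  the defect is finite.\<close>

lemma upper_semi_B_Weyl_of_left_pole: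
  assumes S: "bounded_operator S" and p: "ascent S < \<infinity>"
    and cl: "closed (range (S ^^ (the_enat (ascent S) + 1)))"
  shows "upper_semi_B_Weyl S"
proof -
  define n where "n = the_enat (ascent S)"
  have "kernel S \<inter> range (S ^^ n) \<subseteq> {0}"
    using kernel_range_funpow_disjoint[OF S p order_refl, of 1, folded n_def] by simp
  then have null: "nullity_on (range (S ^^ n)) S = 0" by (rule nullity_on_eq_0)
  have "S ` range (S ^^ n) = range (S ^^ (n + 1))" by (simp add: image_comp)
  then have "closed (S ` range (S ^^ n))" "S ` range (S ^^ n) \<subseteq> range (S ^^ n)"
    using cl range_funpow_antimono[of n "n + 1" S] by (auto simp: n_def)
  then have "closedin (top_of_set (range (S ^^ n))) (S ` range (S ^^ n))"
    by (rule closed_subset[rotated])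
  moreover have "index_on (range (S ^^ n)) S \<le> 0"
    by (simp add: index_on_def null ereal_of_enat_nonneg)
  moreover have "closed (range (S ^^ n))"
    using closed_range_funpow_descends[OF S p _ cl] by (simp add: n_def)
  ultimately show ?thesis
    unfolding upper_semi_B_Weyl_def upper_semi_Fredholm_on_def
    by (intro exI[of _ n] conjI) (simp_all add: null)
qed

section \<open>Nullity and defect\<close>

text \<open>The spanning half of rank-nullity, on a subspace \<open>V\<close> that is not known in advance to be
  finite-dimensional. It serves to bound \<open>N(S\<^sup>n\<^sup>+\<^sup>1)\<close>, which \<open>S\<close> maps into \<open>N(S\<^sup>n)\<close>, and to count
  dimensions in \<open>N(S\<^sup>d)\<close>.\<close>

lemma finite_span_from_kernel_and_image:
  assumes S: "Vector_Spaces.linear scaleC scaleC S" and V: "complex_vector.subspace V"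
    and "finite K" "kernel S \<inter> V \<subseteq> complex_vector.span K"
    and C: "finite C" "C \<subseteq> S ` V" "S ` V \<subseteq> complex_vector.span C"
  obtains D where "finite D" "card D \<le> card K + card C" "V \<subseteq> complex_vector.span D"
proof -
  interpret S: Vector_Spaces.linear scaleC scaleC S by fact
  have "\<exists>v. v \<in> V \<and> S v = c" if "c \<in> C" for c using C(2) that by blast
  then obtain g where g: "\<And>c. c \<in> C \<Longrightarrow> g c \<in> V \<and> S (g c) = c" by metis
  then have SgC: "S ` g ` C = C" by force
  show thesis
  proof
    show "finite (K \<union> g ` C)" using assms by simp
    show "card (K \<union> g ` C) \<le> card K + card C"
      using card_Un_le[of K "g ` C"] card_image_le[OF C(1), of g] by linarith
    show "V \<subseteq> complex_vector.span (K \<union> g ` C)"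
    proof
      fix v assume v: "v \<in> V"
      then have "S v \<in> complex_vector.span (S ` g ` C)" using C(3) SgC by auto
      then have "S v \<in> S ` complex_vector.span (g ` C)" by (simp only: S.span_image)
      then obtain w where w: "w \<in> complex_vector.span (g ` C)" "S w = S v" by auto
      have "w \<in> V" using w(1) g V complex_vector.span_minimal[of "g ` C" V] by blast
      then have "v - w \<in> kernel S \<inter> V"
        using v V w(2) by (simp add: kernel_def S.diff complex_vector.subspace_diff)
      then have "v - w \<in> complex_vector.span (K \<union> g ` C)"
        using assms(4) complex_vector.span_mono[of K "K \<union> g ` C"] by blast
      moreover have "w \<in> complex_vector.span (K \<union> g ` C)"
        using w(1) complex_vector.span_mono[of "g ` C" "K \<union> g ` C"] by blast
      ultimately show "v \<in> complex_vector.span (K \<union> g ` C)"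
        using complex_vector.span_add by fastforce
    qed
  qed
qed

lemma finite_basis_of_subset:
  assumes "finite D" "V \<subseteq> complex_vector.span D"
  obtains C where "finite C" "C \<subseteq> V" "complex_vector.independent C" "V \<subseteq> complex_vector.span C"
    "card C = complex_vector.dim V"
  using complex_vector.basis_exists[of V] complex_vector.independent_span_bound[OF assms(1)] assms(2)
  by (metis order_trans)

lemma finite_span_kernel_funpow:
  assumes S: "bounded_operator S" and K: "finite K" "kernel S \<subseteq> complex_vector.span K"
  shows "\<exists>D. finite D \<and> kernel (S ^^ n) \<subseteq> complex_vector.span D"
proof (induction n)
  case 0
  then show ?case by (intro exI[of _ "{}"]) (auto simp: kernel_def)
next
  case (Suc n)
  then obtain D where D: "finite D" "kernel (S ^^ n) \<subseteq> complex_vector.span D" by blast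
  have "S ` kernel (S ^^ Suc n) \<subseteq> complex_vector.span D"
    using D(2) by (auto simp: kernel_def funpow_swap1)
  then obtain C where C: "finite C" "C \<subseteq> S ` kernel (S ^^ Suc n)"
    "S ` kernel (S ^^ Suc n) \<subseteq> complex_vector.span C"
    using finite_basis_of_subset[OF D(1)] by metis
  have "kernel S \<inter> kernel (S ^^ Suc n) \<subseteq> complex_vector.span K" using K by blast
  then show ?case
    using finite_span_from_kernel_and_image[OF clinear_bounded_operator[OF S]
        csubspace_kernel[OF bounded_operator_funpow[OF S]] K(1) _ C] by metis
qed

text \<open>Let \<open>N = N(S\<^sup>d)\<close> with \<open>d\<close> beyond the descent, so that every vector is congruent modulo the range of
  \<open>S\<close> to a vector of \<open>N\<close>. A set \<open>B\<close> that is independent modulo the range can therefore be moved into \<open>N\<close>;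
  together with a basis \<open>C\<close> of \<open>S ` N\<close> it stays independent. By rank-nullity \<open>N\<close> is spanned by as many
  vectors as a basis of the kernel and \<open>C\<close> have together, which leaves at most the nullity for the
  size of \<open>B\<close>.\<close>

lemma defect_le_nullity:
  assumes S: "bounded_operator S" and desc: "descent S < \<infinity>"
    and fin: "nullity_on UNIV S < \<infinity>"
  shows "defect_on UNIV S \<le> nullity_on UNIV S"
proof -
  note lin = clinear_bounded_operator[OF S]
  interpret S: Vector_Spaces.linear scaleC scaleC S by (rule lin)
  have "\<exists>D. finite D \<and> kernel S \<subseteq> complex_vector.span D"
    using fin by (rule contrapos_pp) (simp add: nullity_on_def cdim_def)
  then obtain D where D: "finite D" "kernel S \<subseteq> complex_vector.span D" by blast
  obtain K where K: "finite K" "K \<subseteq> kernel S" "complex_vector.independent K" "kernel S \<subseteq> complex_vector.span K"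
    "card K = complex_vector.dim (kernel S)"
    using finite_basis_of_subset[OF D] by metis
  have null: "nullity_on UNIV S = enat (card K)"
    using \<open>\<exists>D. finite D \<and> kernel S \<subseteq> complex_vector.span D\<close> K(5)
    by (simp add: nullity_on_def cdim_def)
  \<comment> \<open>The successor ensures \<open>d > 0\<close>, so that \<open>R(S\<^sup>d)\<close> lies in \<open>R(S)\<close>.\<close>
  define d where "d = Suc (the_enat (descent S))"
  define N where "N = kernel (S ^^ d)"
  have N_sub: "complex_vector.subspace N"
    unfolding N_def by (intro csubspace_kernel bounded_operator_funpow S)
  obtain D' where D': "finite D'" "N \<subseteq> complex_vector.span D'"
    using finite_span_kernel_funpow[OF S K(1,4)] by (auto simp: N_def)
  have SN: "S ` N \<subseteq> N"
    using kernel_funpow_mono[OF S, of "d" "Suc d"] by (auto simp: N_def kernel_def funpow_swap1 S.zero)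
  obtain C where C: "finite C" "C \<subseteq> S ` N" "complex_vector.independent C" "S ` N \<subseteq> complex_vector.span C"
    using finite_basis_of_subset[OF D'(1), of "S ` N"] SN D'(2) by (metis order_trans)
  obtain E where E: "finite E" "card E \<le> card K + card C" "N \<subseteq> complex_vector.span E"
    using finite_span_from_kernel_and_image[OF lin N_sub K(1) _ C(1,2,4)] K(4) by blast
  have R: "complex_vector.subspace (range S)" using S by (rule csubspace_range)
  have Cr: "C \<subseteq> range S" using C(2) by blast
  have "card B \<le> card K"
    if B: "finite B" "\<And>c b. (\<Sum>b\<in>B. c b *\<^sub>C b) \<in> range S \<Longrightarrow> b \<in> B \<Longrightarrow> c b = 0" for B
  proof -
    have "\<exists>u. u \<in> N \<and> b - u \<in> range S" for b
    proof -
      obtain u v where "u \<in> N" "v \<in> range (S ^^ d)" "b = u + v"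
        using kernel_range_funpow_sum[OF S desc, of d b] by (auto simp: d_def N_def)
      moreover have "range (S ^^ d) \<subseteq> range S" by (auto simp: d_def)
      ultimately have "b - u \<in> range S" by auto
      then show ?thesis using \<open>u \<in> N\<close> by blast
    qed
    then obtain h where h: "\<And>b. h b \<in> N" "\<And>b. b - h b \<in> range S" by metis
    \<comment> \<open>A combination of \<open>h ` B\<close> is congruent modulo the range to the same one of \<open>B\<close>.\<close>
    have key: "c b = 0" if "(\<Sum>b\<in>B. c b *\<^sub>C h b) \<in> range S" "b \<in> B" for c b
    proof -
      have "(\<Sum>b\<in>B. c b *\<^sub>C (b - h b)) \<in> range S"
        using R h(2) by (intro complex_vector.subspace_sum complex_vector.subspace_scale) auto
      then have "(\<Sum>b\<in>B. c b *\<^sub>C h b) + (\<Sum>b\<in>B. c b *\<^sub>C (b - h b)) \<in> range S"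
        using that R complex_vector.subspace_add by blast
      then have "(\<Sum>b\<in>B. c b *\<^sub>C b) \<in> range S"
        by (simp add: sum.distrib[symmetric] scaleC_add_right[symmetric])
      then show ?thesis using B(2) that by blast
    qed
    have inj: "inj_on h B"
    proof (rule inj_onI, rule ccontr)
      fix a b assume ab: "a \<in> B" "b \<in> B" "h a = h b" "a \<noteq> b"
      let ?c = "\<lambda>x. if x = a then 1 else if x = b then - 1 else (0::complex)"
      have "(\<Sum>x\<in>B. ?c x *\<^sub>C h x) = (\<Sum>x\<in>{a, b}. ?c x *\<^sub>C h x)"
        using ab B(1) by (intro sum.mono_neutral_right) auto
      also have "\<dots> = 0" using ab by (simp add: scaleC_one)
      finally have "(\<Sum>x\<in>B. ?c x *\<^sub>C h x) \<in> range S" using R complex_vector.subspace_0 by metis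
      then have "?c a = 0" using ab(1) by (rule key)
      then show False by simp
    qed
    have disj: "h ` B \<inter> C = {}"
    proof (rule ccontr)
      assume "\<not> ?thesis"
      then obtain b where b: "b \<in> B" "h b \<in> range S" using Cr by blast
      let ?c = "\<lambda>x. if x = b then 1 else (0::complex)"
      have "(\<Sum>x\<in>B. ?c x *\<^sub>C h x) = (\<Sum>x\<in>{b}. ?c x *\<^sub>C h x)"
        using b B(1) by (intro sum.mono_neutral_right) auto
      then have "(\<Sum>x\<in>B. ?c x *\<^sub>C h x) \<in> range S" using b by (simp add: scaleC_one)
      then have "?c b = 0" using b(1) by (rule key)
      then show False by simp
    qed
    have "complex_vector.independent (h ` B \<union> C)"
    proof (rule complex_vector.independent_if_scalars_zero)
      show "finite (h ` B \<union> C)" using B(1) C(1) by simp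
      fix f x assume sum0: "(\<Sum>x\<in>h ` B \<union> C. f x *\<^sub>C x) = 0" and x: "x \<in> h ` B \<union> C"
      have split: "(\<Sum>b\<in>B. f (h b) *\<^sub>C h b) + (\<Sum>x\<in>C. f x *\<^sub>C x) = 0"
        using sum0 B(1) C(1) disj inj by (simp add: sum.union_disjoint sum.reindex)
      have "(\<Sum>x\<in>C. f x *\<^sub>C x) \<in> range S"
        using R Cr by (intro complex_vector.subspace_sum complex_vector.subspace_scale) auto
      then have "(\<Sum>b\<in>B. f (h b) *\<^sub>C h b) \<in> range S"
        using split R complex_vector.subspace_neg by (metis add_eq_0_iff2)
      then have fB: "f (h b) = 0" if "b \<in> B" for b using key[of "\<lambda>b. f (h b)"] that by blast
      then have "(\<Sum>x\<in>C. f x *\<^sub>C x) = 0" using split by simp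
      then have "f x = 0" if "x \<in> C" for x
        using complex_vector.independentD[OF C(3,1)] that by blast
      then show "f x = 0" using x fB by blast
    qed
    moreover have "h ` B \<union> C \<subseteq> complex_vector.span E" using h(1) C(2) SN E(3) by blast
    ultimately have "card (h ` B \<union> C) \<le> card E"
      using complex_vector.independent_span_bound[OF E(1)] by blast
    moreover have "card (h ` B \<union> C) = card B + card C"
      using disj inj B(1) C(1) by (simp add: card_Un_disjoint card_image)
    ultimately show ?thesis using E(2) by simp
  qed
  then show ?thesis
    unfolding defect_on_def quotient_cdim_def null by (intro SUP_least) auto
qed

lemma Weyl_of_upper_semi_Weyl_finite_descent:
  assumes S: "bounded_operator S" and "descent S < \<infinity>"
    and usw: "upper_semi_Weyl S"
  shows "Weyl S"
proof -
  have fin: "nullity_on UNIV S < \<infinity>" and cl: "closed (range S)" and ind: "index_on UNIV S \<le> 0"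
    using usw by (auto simp: upper_semi_Weyl_def upper_semi_Fredholm_on_def)
  have le: "defect_on UNIV S \<le> nullity_on UNIV S"
    using defect_le_nullity assms fin by blast
  obtain a b where ab: "nullity_on UNIV S = enat a" "defect_on UNIV S = enat b"
    using le fin by (metis enat_ord_simps(4) infinity_ileE not_enat_eq)
  then show ?thesis
    using ind le fin cl by (auto simp: Weyl_def Fredholm_def index_on_def zero_ereal_def)
qed

section \<open>Injective Weyl operators\<close>

lemma inverse_of_bijective_bounded_operator:
  assumes S: "bounded_operator S" and "bij S"
  shows "bounded_operator (inv S)"
proof -
  have bl: "bounded_linear S" and sc: "\<And>c x. S (c *\<^sub>C x) = c *\<^sub>C S x"
    using S by (auto simp: bounded_operator_def)
  interpret S: bounded_linear S by fact
  have inv[simp]: "S (inv S y) = y" "inv S (S x) = x" for x y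
    using \<open>bij S\<close> by (auto simp: bij_def surj_f_inv_f)
  obtain M where M: "\<And>y. \<exists>x. S x = y \<and> norm x \<le> M * norm y"
    using bounded_preimages[OF bl, of UNIV UNIV] bij_is_surj[OF \<open>bij S\<close>] by auto
  have "bounded_linear (inv S)"
  proof (rule bounded_linear_intro[where K = M])
    show "inv S (x + y) = inv S x + inv S y" for x y by (metis S.add inv)
    show "inv S (r *\<^sub>R x) = r *\<^sub>R inv S x" for r x by (metis S.scaleR inv)
    show "norm (inv S x) \<le> norm x * M" for x using M by (metis inv(2) mult.commute)
  qed
  moreover have "inv S (c *\<^sub>C x) = c *\<^sub>C inv S x" for c x by (metis sc inv)
  ultimately show ?thesis by (simp add: bounded_operator_def)
qed

text \<open>The index \<open>0\<close> forces the defect to vanish, and a single vector outside the range would already be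
  an independent family of size one modulo the range.\<close>

lemma surj_of_injective_Weyl:
  assumes S: "bounded_operator S" and "Weyl S" and ker: "kernel S = {0}"
  shows "surj S"
proof (rule ccontr)
  assume "\<not> surj S"
  then obtain y where y: "y \<notin> range S" by blast
  have R: "complex_vector.subspace (range S)" using S by (rule csubspace_range)
  have "nullity_on UNIV S = 0" using ker by (intro nullity_on_eq_0) simp
  then have "defect_on UNIV S = 0"
    using \<open>Weyl S\<close> by (cases "defect_on UNIV S") (auto simp: Weyl_def index_on_def zero_enat_def)
  moreover have "enat (card {y}) \<le> defect_on UNIV S"
    unfolding defect_on_def quotient_cdim_def
  proof (rule SUP_upper, intro CollectI conjI allI impI ballI)
    fix c :: "'a \<Rightarrow> complex" and b
    assume "(\<Sum>b\<in>{y}. c b *\<^sub>C b) \<in> range S" "b \<in> {y}"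
    then have "c y *\<^sub>C y \<in> range S" by simp
    then have "inverse (c y) *\<^sub>C (c y *\<^sub>C y) \<in> range S"
      using R complex_vector.subspace_scale by blast
    then have "c y = 0" using y by (cases "c y = 0") (auto simp: scaleC_scaleC scaleC_one)
    then show "c b = 0" using \<open>b \<in> {y}\<close> by simp
  qed auto
  ultimately show False by (simp add: zero_enat_def)
qed

lemma approx_point_spectrum_if_Weyl:
  assumes T: "bounded_operator T" and "\<mu> \<in> spectrum T" "Weyl (shift T \<mu>)"
  shows "\<mu> \<in> approx_point_spectrum T"
proof -
  let ?S = "shift T \<mu>"
  have S: "bounded_operator ?S" using T by (rule bounded_operator_shift)
  then interpret S: bounded_linear ?S by (simp add: bounded_operator_def)
  have "kernel ?S \<noteq> {0}"
  proof
    assume ker: "kernel ?S = {0}"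
    have "inj ?S" using ker S.linear linear_injective_0 by (auto simp: kernel_def)
    then have bij: "bij ?S" using surj_of_injective_Weyl[OF S assms(3) ker] by (simp add: bij_def)
    then have "inv ?S \<circ> ?S = id" "?S \<circ> inv ?S = id"
      by (auto simp: fun_eq_iff bij_def surj_f_inv_f)
    then show False
      using inverse_of_bijective_bounded_operator[OF S bij] assms(2) by (auto simp: spectrum_def)
  qed
  moreover have "0 \<in> kernel ?S" by (simp add: kernel_def S.zero)
  ultimately obtain x where "x \<in> kernel ?S" "x \<noteq> 0" by blast
  then have x: "x \<noteq> 0" "?S x = 0" by (simp_all add: kernel_def)
  have "norm ((1 / norm x) *\<^sub>R x) = 1" "?S ((1 / norm x) *\<^sub>R x) = 0"
    using x by (auto simp: S.scaleR)
  then show ?thesis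
    unfolding approx_point_spectrum_def by (intro CollectI exI[of _ "\<lambda>_. (1 / norm x) *\<^sub>R x"]) simp
qed

section \<open>Poles, left poles and the Weyl spectra\<close>

lemma upper_semi_Weyl_of_Weyl: "Weyl S \<Longrightarrow> upper_semi_Weyl S"
  by (simp add: Weyl_def Fredholm_def upper_semi_Weyl_def upper_semi_Fredholm_on_def)

lemma left_pole_of_pole:
  assumes T: "bounded_operator T" and "\<mu> \<in> poles T" "\<mu> \<in> approx_point_spectrum T"
  shows "\<mu> \<in> left_poles T"
proof -
  have fin: "ascent (shift T \<mu>) < \<infinity>" "descent (shift T \<mu>) < \<infinity>"
    using assms(2) by (auto simp: poles_def)
  then have "closed (range (shift T \<mu> ^^ (the_enat (ascent (shift T \<mu>)) + 1)))"
    by (intro closed_range_funpow_of_pole bounded_operator_shift T) simp_all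
  then show ?thesis using fin assms(3) unfolding left_poles_def by blast
qed

lemma left_poles_disjoint_upper_semi_B_Weyl_spectrum:
  assumes "bounded_operator T"
  shows "left_poles T \<inter> upper_semi_B_Weyl_spectrum T = {}"
  using upper_semi_B_Weyl_of_left_pole[OF bounded_operator_shift[OF assms]]
  by (auto simp: left_poles_def upper_semi_B_Weyl_spectrum_def)

lemma property_Z_Pi_a_if_left_poles_disjoint:
  assumes T: "bounded_operator T" and UW: "property_UW_Pi T"
    and disj: "left_poles T \<inter> upper_semi_Weyl_spectrum T = {}"
  shows "property_Z_Pi_a T"
  unfolding property_Z_Pi_a_def
proof (intro equalityI subsetI)
  fix \<mu> assume "\<mu> \<in> spectrum T - Weyl_spectrum T"
  then have \<mu>: "\<mu> \<in> spectrum T" "Weyl (shift T \<mu>)" by (auto simp: Weyl_spectrum_def)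
  then have "\<mu> \<in> approx_point_spectrum T" using approx_point_spectrum_if_Weyl[OF T] by blast
  moreover have "\<mu> \<notin> upper_semi_Weyl_spectrum T"
    using upper_semi_Weyl_of_Weyl[OF \<mu>(2)] by (simp add: upper_semi_Weyl_spectrum_def)
  ultimately show "\<mu> \<in> left_poles T"
    using UW left_pole_of_pole[OF T] by (auto simp: property_UW_Pi_def)
next
  fix \<mu> assume \<mu>: "\<mu> \<in> left_poles T"
  then have usw: "\<mu> \<notin> upper_semi_Weyl_spectrum T" using disj by blast
  then have "\<mu> \<in> poles T"
    using \<mu> UW by (auto simp: property_UW_Pi_def left_poles_def)
  then show "\<mu> \<in> spectrum T - Weyl_spectrum T"
    using usw Weyl_of_upper_semi_Weyl_finite_descent[OF bounded_operator_shift[OF T]]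
    by (simp add: poles_def Weyl_spectrum_def upper_semi_Weyl_spectrum_def)
qed

theorem theorem3p7:
  fixes T :: "'a::complex_banach \<Rightarrow> 'a"
  assumes "cdim (UNIV :: 'a set) = \<infinity>"
    and "bounded_operator T"
    and "property_UW_Pi T"
  shows "(left_poles T \<inter> upper_semi_Weyl_spectrum T = {} \<longrightarrow> property_Z_Pi_a T) \<and>
         (upper_semi_Weyl_spectrum T = upper_semi_B_Weyl_spectrum T \<longrightarrow> property_Z_Pi_a T)"
  using property_Z_Pi_a_if_left_poles_disjoint[OF assms(2,3)]
    left_poles_disjoint_upper_semi_B_Weyl_spectrum[OF assms(2)] by simp

end
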